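(* Let $\mathsf{GT}:\{0,1\}^n\times\{0,1\}^n\to\{0,1\}$ be the greater-than function $\mathsf{GT}(x,y)=\mathbf{1}[x\ge y]$, where $x,y$ are viewed as integers in $[2^n]$. Then $\bar{\mathrm{R}}_\varepsilon(\mathsf{GT})\le\tilde{O}(\log(n)/\varepsilon^{2/3})$.
   Context: Distributed estimation: Alice holds a probability distribution $p$ on $\{0,1\}^n$, Bob a probability distribution $q$ on $\{0,1\}^n$, and they must output an estimate within additive error $\varepsilon$ of $\mathbb{E}_{x\sim p,y\sim q}[f(x,y)]$. $\bar{\mathrm{R}}_\varepsilon(f)$ is the minimum worst-case communication of a shared-randomness randomized protocol succeeding with probability at least $2/3$ on every input pair. $\tilde{O}$ hides polylogarithmic factors in $1/\varepsilon$ only. *)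

theory Defs
  imports "HOL-Probability.Probability"
begin

text \<open>Deterministic two-party protocol trees. At an inner node the named player sends one bit,
  computed from that player's input; the protocol continues in the first subtree if the bit is
  1 and in the second one if it is 0. The output is determined by the leaf reached,
  that is, by the transcript.\<close>

datatype ('a, 'b, 'o) protocol =
    Output 'o
  | Alice "'a \<Rightarrow> bool" "('a, 'b, 'o) protocol" "('a, 'b, 'o) protocol"
  | Bob "'b \<Rightarrow> bool" "('a, 'b, 'o) protocol" "('a, 'b, 'o) protocol"

primrec run :: "('a, 'b, 'o) protocol \<Rightarrow> 'a \<Rightarrow> 'b \<Rightarrow> 'o" where
  "run (Output v) a b = v"
| "run (Alice g P Q) a b = (if g a then run P a b else run Q a b)"
| "run (Bob h P Q) a b = (if h b then run P a b else run Q a b)"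

primrec cost :: "('a, 'b, 'o) protocol \<Rightarrow> nat" where
  "cost (Output v) = 0"
| "cost (Alice g P Q) = Suc (max (cost P) (cost Q))"
| "cost (Bob h P Q) = Suc (max (cost P) (cost Q))"

definition mean_value :: "('x \<Rightarrow> 'y \<Rightarrow> real) \<Rightarrow> 'x pmf \<Rightarrow> 'y pmf \<Rightarrow> real" where
  "mean_value f p q = measure_pmf.expectation (pair_pmf p q) (\<lambda>(x, y). f x y)"

text \<open>A shared-randomness protocol is a probability distribution over deterministic protocols.
  The players' inputs are themselves probability distributions, on \<open>X\<close> and \<open>Y\<close>.\<close>

definition estimates ::
  "('x pmf, 'y pmf, real) protocol pmf \<Rightarrow> 'x set \<Rightarrow> 'y set \<Rightarrow> ('x \<Rightarrow> 'y \<Rightarrow> real) \<Rightarrow> real \<Rightarrow> bool"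
where
  "estimates D X Y f \<epsilon> \<longleftrightarrow>
     (\<forall>p q. set_pmf p \<subseteq> X \<longrightarrow> set_pmf q \<subseteq> Y \<longrightarrow>
        measure_pmf.prob D {\<pi>. \<bar>run \<pi> p q - mean_value f p q\<bar> \<le> \<epsilon>} \<ge> 2 / 3)"

text \<open>Extended naturals make the infimum \<open>\<infinity>\<close> if no protocol of bounded cost exists;
  otherwise it is a minimum.\<close>

definition dist_est_complexity ::
  "'x set \<Rightarrow> 'y set \<Rightarrow> ('x \<Rightarrow> 'y \<Rightarrow> real) \<Rightarrow> real \<Rightarrow> enat"
where
  "dist_est_complexity X Y f \<epsilon> =
     Inf {enat c | c. \<exists>D. (\<forall>\<pi>\<in>set_pmf D. cost \<pi> \<le> c) \<and> estimates D X Y f \<epsilon>}"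

definition cube :: "nat \<Rightarrow> bool list set" where
  "cube n = {x. length x = n}"

text \<open>Most significant bit first.\<close>

definition bits_val :: "bool list \<Rightarrow> nat" where
  "bits_val x = horner_sum of_bool 2 (rev x)"

definition greater_than :: "bool list \<Rightarrow> bool list \<Rightarrow> real" where
  "greater_than x y = of_bool (bits_val x \<ge> bits_val y)"

end

theory Submission
  imports Defs
begin

text \<open>Let \<open>X\<close> and \<open>Y\<close> be the quantile functions of the two distributions, sampled on a grid of \<open>N\<close>
  points; by monotonicity this changes the mean by at most \<open>2/N\<close>. Cut the unit square into
  \<open>m \<times> m\<close> blocks. As \<open>X\<close> and \<open>Y\<close> are nondecreasing, \<open>\<one>[X(u) \<ge> Y(v)]\<close> is constant on all but
  \<open>2m\<close> of the blocks, which form a staircase that the players can follow with \<open>2m\<close> comparisons of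
  block corners. On each staircase block they compare one independent uniform sample. The
  resulting estimate is unbiased with variance at most \<open>2m/m\<^sup>4\<close>, so \<open>m = O(\<epsilon> powr (-2/3))\<close> suffices.
  A single comparison of \<open>n\<close>-bit numbers with error \<open>2 powr (-d)\<close> costs \<open>O(log n + d)\<close> bits, by a noisy
  binary search with backtracking for the first differing bit, where prefixes are compared by
  hashing.\<close>

section \<open>Randomized functions computed by protocols\<close>

text \<open>After a leaf \<open>v\<close> of the first protocol the players continue with a fresh random protocol
  \<open>k v\<close>, drawn independently for each leaf.\<close>

primrec graft ::
  "('a, 'b, 'o) protocol \<Rightarrow> ('o \<Rightarrow> ('a, 'b, 'r) protocol pmf) \<Rightarrow> ('a, 'b, 'r) protocol pmf" where
  "graft (Output v) k = k v"
| "graft (Alice g P Q) k = bind_pmf (graft P k) (\<lambda>P'. map_pmf (Alice g P') (graft Q k))"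
| "graft (Bob h P Q) k = bind_pmf (graft P k) (\<lambda>P'. map_pmf (Bob h P') (graft Q k))"

text \<open>The continuations at leaves other than the one reached by \<open>(a, b)\<close> are
  drawn as well, but independently, so they integrate out.\<close>

lemma map_run_graft:
  "map_pmf (\<lambda>\<pi>. run \<pi> a b) (graft P k) = map_pmf (\<lambda>\<pi>. run \<pi> a b) (k (run P a b))"
proof (induction P)
  case (Alice g P Q)
  have "map_pmf (\<lambda>\<pi>. run \<pi> a b) (graft (Alice g P Q) k) =
      (if g a then map_pmf (\<lambda>\<pi>. run \<pi> a b) (graft P k) else map_pmf (\<lambda>\<pi>. run \<pi> a b) (graft Q k))"
    by (simp add: map_bind_pmf map_pmf_comp bind_return_pmf' flip: map_pmf_def)
  then show ?case by (simp add: Alice)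
next
  case (Bob g P Q)
  have "map_pmf (\<lambda>\<pi>. run \<pi> a b) (graft (Bob g P Q) k) =
      (if g b then map_pmf (\<lambda>\<pi>. run \<pi> a b) (graft P k) else map_pmf (\<lambda>\<pi>. run \<pi> a b) (graft Q k))"
    by (simp add: map_bind_pmf map_pmf_comp bind_return_pmf' flip: map_pmf_def)
  then show ?case by (simp add: Bob)
qed simp

lemma cost_graft:
  assumes "\<And>v \<pi>. \<pi> \<in> set_pmf (k v) \<Longrightarrow> cost \<pi> \<le> c" "\<pi> \<in> set_pmf (graft P k)"
  shows "cost \<pi> \<le> cost P + c"
  using assms(2)
proof (induction P arbitrary: \<pi>)
  case (Output v)
  then show ?case using assms(1) by simp
next
  case (Alice g P Q)
  from Alice.prems obtain P' Q' where
    "P' \<in> set_pmf (graft P k)" "Q' \<in> set_pmf (graft Q k)" "\<pi> = Alice g P' Q'"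
    by auto
  with Alice.IH(1)[of P'] Alice.IH(2)[of Q'] show ?case by auto
next
  case (Bob g P Q)
  from Bob.prems obtain P' Q' where
    "P' \<in> set_pmf (graft P k)" "Q' \<in> set_pmf (graft Q k)" "\<pi> = Bob g P' Q'"
    by auto
  with Bob.IH(1)[of P'] Bob.IH(2)[of Q'] show ?case by auto
qed

text \<open>Only the output law for each single input pair is prescribed. Protocols can then be
  composed as random computations in the \<open>pmf\<close> monad, without mentioning trees.\<close>

definition computes :: "'a set \<Rightarrow> 'b set \<Rightarrow> nat \<Rightarrow> ('a \<Rightarrow> 'b \<Rightarrow> 'o pmf) \<Rightarrow> bool" where
  "computes A B c K \<longleftrightarrow> (\<exists>D. (\<forall>\<pi>\<in>set_pmf D. cost \<pi> \<le> c) \<and>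
     (\<forall>a\<in>A. \<forall>b\<in>B. map_pmf (\<lambda>\<pi>. run \<pi> a b) D = K a b))"

lemma computes_mono: "computes A B c K \<Longrightarrow> c \<le> c' \<Longrightarrow> computes A B c' K"
  unfolding computes_def by (meson order_trans)

lemma computes_return: "computes A B c (\<lambda>a b. return_pmf v)"
  unfolding computes_def by (intro exI[of _ "return_pmf (Output v)"]) simp

lemma computes_Alice: "computes A B 1 (\<lambda>a b. return_pmf (g a :: bool))"
  unfolding computes_def
  by (intro exI[of _ "return_pmf (Alice g (Output True) (Output False))"]) simp

lemma computes_Bob: "computes A B 1 (\<lambda>a b. return_pmf (h b :: bool))"
  unfolding computes_def
  by (intro exI[of _ "return_pmf (Bob h (Output True) (Output False))"]) simp

text \<open>The intermediate value \<open>v\<close> is determined by the leaf reached, so both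
  players know it and may choose the continuation \<open>K' v\<close> by it.\<close>

lemma computes_bind:
  assumes "computes A B c K" "\<And>v. computes A B c' (K' v)"
  shows "computes A B (c + c') (\<lambda>a b. bind_pmf (K a b) (\<lambda>v. K' v a b))"
proof -
  obtain D where D: "\<And>\<pi>. \<pi> \<in> set_pmf D \<Longrightarrow> cost \<pi> \<le> c"
    "\<And>a b. a \<in> A \<Longrightarrow> b \<in> B \<Longrightarrow> map_pmf (\<lambda>\<pi>. run \<pi> a b) D = K a b"
    using assms(1) unfolding computes_def by auto
  obtain E where E: "\<And>v \<pi>. \<pi> \<in> set_pmf (E v) \<Longrightarrow> cost \<pi> \<le> c'"
    "\<And>v a b. a \<in> A \<Longrightarrow> b \<in> B \<Longrightarrow> map_pmf (\<lambda>\<pi>. run \<pi> a b) (E v) = K' v a b"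
    using assms(2) unfolding computes_def by metis
  have "cost \<pi> \<le> c + c'" if "\<pi> \<in> set_pmf (bind_pmf D (\<lambda>P. graft P E))" for \<pi>
  proof -
    from that obtain P where "P \<in> set_pmf D" "\<pi> \<in> set_pmf (graft P E)"
      by auto
    with D(1)[of P] cost_graft[where k = E and c = c', of \<pi> P] E(1) show ?thesis by fastforce
  qed
  moreover have "map_pmf (\<lambda>\<pi>. run \<pi> a b) (bind_pmf D (\<lambda>P. graft P E)) = bind_pmf (K a b) (\<lambda>v. K' v a b)"
    if "a \<in> A" "b \<in> B" for a b
    using that by (simp add: map_bind_pmf map_run_graft E(2) D(2)[symmetric] bind_map_pmf)
  ultimately show ?thesis
    unfolding computes_def by blast
qed

text \<open>Shared randomness is free: \<open>r\<close> is drawn together with the protocol, before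
  any communication.\<close>

lemma computes_shared:
  assumes "\<And>r. computes A B c (K r)"
  shows "computes A B c (\<lambda>a b. bind_pmf R (\<lambda>r. K r a b))"
proof -
  obtain E where "\<And>r \<pi>. \<pi> \<in> set_pmf (E r) \<Longrightarrow> cost \<pi> \<le> c"
    "\<And>r a b. a \<in> A \<Longrightarrow> b \<in> B \<Longrightarrow> map_pmf (\<lambda>\<pi>. run \<pi> a b) (E r) = K r a b"
    using assms unfolding computes_def by metis
  then show ?thesis
    unfolding computes_def by (intro exI[of _ "bind_pmf R E"]) (auto simp: map_bind_pmf)
qed

primrec comap_protocol ::
  "('c \<Rightarrow> 'a) \<Rightarrow> ('d \<Rightarrow> 'b) \<Rightarrow> ('a, 'b, 'o) protocol \<Rightarrow> ('c, 'd, 'o) protocol" where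
  "comap_protocol f h (Output v) = Output v"
| "comap_protocol f h (Alice g P Q) =
     Alice (g \<circ> f) (comap_protocol f h P) (comap_protocol f h Q)"
| "comap_protocol f h (Bob g P Q) =
     Bob (g \<circ> h) (comap_protocol f h P) (comap_protocol f h Q)"

lemma run_comap_protocol [simp]: "run (comap_protocol f h P) a b = run P (f a) (h b)"
  by (induction P) auto

lemma cost_comap_protocol [simp]: "cost (comap_protocol f h P) = cost P"
  by (induction P) auto

text \<open>Each player may transform the own input locally at no cost.\<close>

lemma computes_comap:
  assumes "computes A B c K" "\<And>a. a \<in> A' \<Longrightarrow> f a \<in> A" "\<And>b. b \<in> B' \<Longrightarrow> h b \<in> B"
  shows "computes A' B' c (\<lambda>a b. K (f a) (h b))"
proof -
  obtain D where "\<forall>\<pi>\<in>set_pmf D. cost \<pi> \<le> c"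
    "\<And>a b. a \<in> A \<Longrightarrow> b \<in> B \<Longrightarrow> map_pmf (\<lambda>\<pi>. run \<pi> a b) D = K a b"
    using assms(1) unfolding computes_def by auto
  then show ?thesis
    unfolding computes_def
    by (intro exI[of _ "map_pmf (comap_protocol f h) D"]) (auto simp: assms map_pmf_comp)
qed

section \<open>Total probability for mixtures, and separation of two points by a random set\<close>

lemma measure_bind_pmf:
  "measure_pmf.prob (bind_pmf p f) S = measure_pmf.expectation p (\<lambda>x. measure_pmf.prob (f x) S)"
proof -
  have "ennreal (measure_pmf.prob (bind_pmf p f) S) =
      ennreal (measure_pmf.expectation p (\<lambda>x. measure_pmf.prob (f x) S))"
    by (subst nn_integral_eq_integral[symmetric])
      (auto simp: measure_pmf.emeasure_eq_measure[symmetric] intro!: measure_pmf.integrable_const_bound[where B=1])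
  then show ?thesis
    by (subst (asm) ennreal_inj) auto
qed

lemma pmf_False: "pmf p False = 1 - pmf p True"
  using sum_pmf_eq_1[of UNIV p, OF finite subset_UNIV] by (simp add: UNIV_bool)

lemma prob_bind_bool:
  fixes p :: "bool pmf"
  shows "measure_pmf.prob (bind_pmf p f) S =
    pmf p True * measure_pmf.prob (f True) S + (1 - pmf p True) * measure_pmf.prob (f False) S"
  by (subst measure_bind_pmf, subst integral_measure_pmf[of UNIV])
    (auto simp: UNIV_bool pmf_False)

text \<open>Toggling the membership of \<open>x\<close> is a bijection between the sets that treat
  \<open>x\<close> and \<open>y\<close> alike and those that separate them.\<close>

lemma pmf_of_set_Pow_separates:
  assumes "finite U" "x \<in> U" "x \<noteq> y"
  shows "pmf (map_pmf (\<lambda>S. x \<in> S \<longleftrightarrow> y \<in> S) (pmf_of_set (Pow U))) True = 1 / 2"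
proof -
  let ?E = "{S \<in> Pow U. x \<in> S \<longleftrightarrow> y \<in> S}"
  let ?N = "{S \<in> Pow U. \<not> (x \<in> S \<longleftrightarrow> y \<in> S)}"
  have "bij_betw (\<lambda>S. if x \<in> S then S - {x} else insert x S) ?E ?N"
    using assms(2,3)
    by (intro bij_betwI[where g = "\<lambda>S. if x \<in> S then S - {x} else insert x S"]) auto
  then have "card ?E = card ?N"
    by (rule bij_betw_same_card)
  moreover have "card (Pow U) = card ?E + card ?N"
    using assms(1) by (subst card_Un_disjoint[symmetric]) (auto intro!: arg_cong[of _ _ card])
  moreover have "card (Pow U) > 0"
    using assms(1) by (simp add: card_Pow)
  moreover have "pmf (map_pmf (\<lambda>S. x \<in> S \<longleftrightarrow> y \<in> S) (pmf_of_set (Pow U))) True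
      = card ?E / card (Pow U)"
    using assms(1) by (subst pmf_map, subst measure_pmf_of_set) (auto simp: vimage_def Int_def)
  ultimately show ?thesis
    by (simp add: field_simps)
qed

section \<open>Comparison by noisy binary search\<close>

text \<open>A shared random subset of \<open>U\<close> acts as a one-bit hash function. The error is
  one-sided: equal arguments always pass all \<open>c\<close> rounds.\<close>

primrec eq_test :: "'a set \<Rightarrow> nat \<Rightarrow> 'a \<Rightarrow> 'a \<Rightarrow> bool pmf" where
  "eq_test U 0 x y = return_pmf True"
| "eq_test U (Suc c) x y =
     bind_pmf (map_pmf (\<lambda>S. x \<in> S \<longleftrightarrow> y \<in> S) (pmf_of_set (Pow U)))
       (\<lambda>b. if b then eq_test U c x y else return_pmf False)"

lemma eq_test_refl: "eq_test U c x x = return_pmf True"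
  by (induction c) (simp_all add: bind_return_pmf)

lemma eq_test_neq:
  assumes "finite U" "x \<in> U" "x \<noteq> y"
  shows "pmf (eq_test U c x y) True = (1 / 2) ^ c"
proof (induction c)
  case (Suc c)
  then show ?case
    using pmf_of_set_Pow_separates[OF assms]
    by (simp add: prob_bind_bool flip: measure_pmf_single)
qed simp

lemma computes_eq_test: "computes A B (2 * c) (eq_test U c)"
proof (induction c)
  case 0
  then show ?case by (simp add: computes_return)
next
  case (Suc c)
  have "computes A B (1 + (1 + 0)) (\<lambda>x y. bind_pmf (pmf_of_set (Pow U))
      (\<lambda>S. bind_pmf (return_pmf (x \<in> S)) (\<lambda>b. bind_pmf (return_pmf (y \<in> S)) (\<lambda>b'. return_pmf (b = b')))))"
    by (intro computes_shared computes_bind computes_Alice computes_Bob computes_return)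
  then have *: "computes A B 2 (\<lambda>x y. map_pmf (\<lambda>S. x \<in> S \<longleftrightarrow> y \<in> S) (pmf_of_set (Pow U)))"
    by (simp add: bind_return_pmf map_pmf_def numeral_2_eq_2)
  have "computes A B (2 * c) (\<lambda>x y. if b then eq_test U c x y else return_pmf False)" for b
    using Suc by (cases b) (simp_all add: computes_return)
  then have "computes A B (2 + 2 * c) (eq_test U (Suc c))"
    unfolding eq_test.simps by (rule computes_bind[OF *])
  then show ?case
    by (simp only: mult_Suc_right)
qed

text \<open>The state \<open>(e, a)\<close> of the search stands for the dyadic interval \<open>[a 2\<^sup>e, (a + 1) 2\<^sup>e)\<close>. A step
  tests the upper end again and retreats to the parent interval if the test fails; otherwise it
  descends into one of the two halves. The lower end is never tested, because answers \<open>False\<close> are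
  always correct.\<close>

primrec search :: "(nat \<Rightarrow> bool pmf) \<Rightarrow> nat \<Rightarrow> nat \<Rightarrow> nat \<Rightarrow> nat pmf" where
  "search \<tau> 0 e a = return_pmf (a * 2 ^ e)"
| "search \<tau> (Suc s) e a = bind_pmf (\<tau> ((a + 1) * 2 ^ e - 1)) (\<lambda>b.
     if b then bind_pmf (\<tau> ((2 * a + 1) * 2 ^ (e - 1) - 1))
       (\<lambda>b'. search \<tau> s (e - 1) (if b' then 2 * a else 2 * a + 1))
     else search \<tau> s (Suc e) (a div 2))"

lemma convex_bound_bool:
  fixes q u v w :: real
  assumes "0 \<le> q" "q \<le> 1" "u \<le> w" "v \<le> w"
  shows "q * u + (1 - q) * v \<le> w"
  using convex_bound_le[of u w v q "1 - q"] assms by simp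

text \<open>If \<open>k\<close> is the level of the lowest ancestor that contains the threshold \<open>\<theta>\<close>, then
  \<open>2 k - e\<close> is the number of steps from \<open>(e, a)\<close> up to this ancestor and down to level \<open>0\<close>.
  It decreases by one with probability at least \<open>7/8\<close> and increases by one otherwise, so the
  expectation of \<open>2 ^ (2 k - e)\<close> shrinks by a factor \<open>7/16 + 2/8 \<le> 3/4\<close> in each step.\<close>

lemma search_error:
  assumes above: "\<And>j. \<theta> \<le> j \<Longrightarrow> \<tau> j = return_pmf True"
    and below: "\<And>j. j < \<theta> \<Longrightarrow> pmf (\<tau> j) True \<le> 1 / 8"
    and "s \<le> e" "e \<le> k" "a * 2 ^ e \<le> \<theta>" "a div 2 ^ (k - e) = \<theta> div 2 ^ k"
  shows "measure_pmf.prob (search \<tau> s e a) {v. v div 2 ^ W \<noteq> \<theta> div 2 ^ W}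
    \<le> 2 ^ (2 * k - e) * (3 / 4) ^ s / 2 ^ W"
  using assms(3-6)
proof (induction s arbitrary: e a k)
  case 0
  show ?case
  \<comment> \<open>For \<open>k \<le> W\<close> the common ancestor at level \<open>k\<close> lies
    in a single interval of length \<open>2 ^ W\<close>, so the result is correct. For
    \<open>k > W\<close> the claimed bound is at least 1.\<close>
  proof (cases "k \<le> W")
    case True
    have pow: "(2::nat) ^ W = 2 ^ k * 2 ^ (W - k)" "(2::nat) ^ k = 2 ^ e * 2 ^ (k - e)"
      using True 0 by (simp_all flip: power_add)
    have "a * 2 ^ e div 2 ^ k = a div 2 ^ (k - e)"
      by (subst pow(2), subst div_mult2_eq) simp
    also have "\<dots> = \<theta> div 2 ^ k"
      by (rule 0(4))
    finally have *: "a * 2 ^ e div 2 ^ k = \<theta> div 2 ^ k" .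
    have "a * 2 ^ e div 2 ^ W = \<theta> div 2 ^ W"
      unfolding pow(1) div_mult2_eq * by (rule refl)
    then have "measure_pmf.prob (search \<tau> 0 e a) {v. v div 2 ^ W \<noteq> \<theta> div 2 ^ W} = 0"
      by (simp only: search.simps measure_return_pmf indicator_def mem_Collect_eq) simp
    then show ?thesis by (simp only:) simp
  next
    case False
    then have "(2::real) ^ W \<le> 2 ^ (2 * k - e)"
      using 0 by (intro power_increasing) auto
    then have "1 \<le> (2::real) ^ (2 * k - e) / 2 ^ W"
      by simp
    then show ?thesis
      by (intro order_trans[OF measure_pmf.prob_le_1]) simp
  qed
next
  case (Suc s)
  let ?S = "{v. v div 2 ^ W \<noteq> \<theta> div 2 ^ W}"
  obtain e' where e: "e = Suc e'" "s \<le> e'"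
    using Suc.prems(1) by (cases e) auto
  show ?case
  proof (cases "\<theta> < (a + 1) * 2 ^ e")
    case True
    define u :: real where "u = 2 ^ e' * (3 / 4) ^ s / 2 ^ W"
    have u0: "u \<ge> 0" by (simp add: u_def)
    have a: "a = \<theta> div 2 ^ e"
      using True Suc.prems(3) by (intro div_nat_eqI[symmetric]) (auto simp: mult.commute)
    \<comment> \<open>The current interval contains \<theta>, so \<open>k\<close> can be lowered to
      \<open>e\<close>; for \<open>k = e\<close> the claimed bound is exactly
      \<open>3 / 2 * u\<close>.\<close>
    have goal: "3 / 2 * u \<le> 2 ^ (2 * k - e) * (3 / 4) ^ Suc s / 2 ^ W"
    proof -
      have "(2::real) ^ e \<le> 2 ^ (2 * k - e)"
        using Suc.prems(2) by (intro power_increasing) auto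
      then have "2 ^ e * (3 / 4) ^ Suc s / 2 ^ W \<le> (2::real) ^ (2 * k - e) * (3 / 4) ^ Suc s / 2 ^ W"
        by (intro divide_right_mono mult_right_mono) auto
      then show ?thesis by (simp add: u_def e)
    qed
    define m where "m = (2 * a + 1) * 2 ^ e' - 1"
    have "\<tau> ((a + 1) * 2 ^ e - 1) = return_pmf True"
      using True by (intro above) auto
    then have srch: "search \<tau> (Suc s) e a =
        bind_pmf (\<tau> m) (\<lambda>b'. search \<tau> s e' (if b' then 2 * a else 2 * a + 1))"
      by (simp add: e m_def bind_return_pmf)
    show ?thesis
    proof (cases "\<theta> \<le> m")
      case True
      have "2 * a * 2 ^ e' \<le> \<theta>"
        using Suc.prems(3) e by (simp add: mult_ac)
      moreover have "(2 * a + 1) * 2 ^ e' > 0"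
        by simp
      then have "\<theta> < (2 * a + 1) * 2 ^ e'"
        using True unfolding m_def by linarith
      then have "2 * a div 2 ^ (e' - e') = \<theta> div 2 ^ e'"
        using \<open>2 * a * 2 ^ e' \<le> \<theta>\<close>
        by (simp, intro div_nat_eqI[symmetric]) (auto simp: mult.commute)
      ultimately have "measure_pmf.prob (search \<tau> s e' (2 * a)) ?S \<le> u"
        using Suc.IH[of e' e' "2 * a"] e by (simp add: u_def)
      moreover have "search \<tau> (Suc s) e a = search \<tau> s e' (2 * a)"
        by (simp add: srch above[OF True] bind_return_pmf del: search.simps)
      ultimately show ?thesis
        using goal u0 by (simp only:)
    next
      case False
      have le: "(2 * a + 1) * 2 ^ e' \<le> \<theta>"
        using False by (simp add: m_def)
      have *: "2 * a + 1 = \<theta> div 2 ^ e'"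
        using le True by (intro div_nat_eqI[symmetric]) (auto simp: e algebra_simps)
      have 1: "measure_pmf.prob (search \<tau> s e' (2 * a + 1)) ?S \<le> u"
        using Suc.IH[of e' e' "2 * a + 1"] e le * by (simp add: u_def)
      have "2 * a * 2 ^ e' \<le> \<theta>"
        using le by (simp add: algebra_simps)
      \<comment> \<open>After a descent into the wrong half the lowest good ancestor is the parent
        at level \<open>e\<close>. The exponent becomes \<open>2 * e - e' = e' + 2\<close> instead
        of \<open>e'\<close>, whence the factor 4.\<close>
      then have 2: "measure_pmf.prob (search \<tau> s e' (2 * a)) ?S \<le> 4 * u"
        using Suc.IH[of e' e "2 * a"] e a by (simp add: u_def)
      have "pmf (\<tau> m) True * measure_pmf.prob (search \<tau> s e' (2 * a)) ?S
          \<le> pmf (\<tau> m) True * (4 * u)"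
        by (intro mult_left_mono 2) auto
      moreover have "(1 - pmf (\<tau> m) True) * measure_pmf.prob (search \<tau> s e' (2 * a + 1)) ?S
          \<le> (1 - pmf (\<tau> m) True) * u"
        by (intro mult_left_mono 1) (auto simp: pmf_le_1)
      moreover have "pmf (\<tau> m) True * (3 * u) \<le> 1 / 8 * (3 * u)"
        using below[of m] False u0 by (intro mult_right_mono) auto
      ultimately have "measure_pmf.prob (search \<tau> (Suc s) e a) ?S \<le> 3 / 2 * u"
        using u0 unfolding srch prob_bind_bool by (simp add: algebra_simps)
      then show ?thesis using goal by linarith
    qed
  next
    case False
    \<comment> \<open>Now \<theta> lies above the interval, and \<open>u\<close> is the bound after
      the correct move, a retreat. A descent costs a factor 4, and \<open>u + 3 * u / 8\<close> is
      still below \<open>3 / 2 * u\<close>.\<close>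
    define u :: real where "u = 2 ^ (2 * k - Suc e) * (3 / 4) ^ s / 2 ^ W"
    have u0: "u \<ge> 0" by (simp add: u_def)
    have "k \<noteq> e"
    proof
      assume "k = e"
      then have "a = \<theta> div 2 ^ e" using Suc.prems(4) by simp
      then show False
        using False by (metis Suc_eq_plus1 dividend_less_times_div mult.commute mult_Suc_right
            zero_less_numeral zero_less_power add.commute)
    qed
    then have ek: "Suc e \<le> k" using Suc.prems(2) by simp
    define m where "m = (a + 1) * 2 ^ e - 1"
    have "(a + 1) * 2 ^ e > 0"
      by simp
    then have "m < \<theta>"
      using False unfolding m_def by linarith
    have "(a div 2) * 2 ^ Suc e \<le> \<theta>"
    proof -
      have "(a div 2) * 2 ^ Suc e = (a div 2 * 2) * 2 ^ e" by simp
      also have "\<dots> \<le> a * 2 ^ e" by (intro mult_right_mono) auto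
      also note Suc.prems(3)
      finally show ?thesis .
    qed
    moreover have kk: "k - e = Suc (k - Suc e)" "k - e' = Suc (k - e)"
      using ek e by auto
    moreover have "a div 2 div 2 ^ (k - Suc e) = \<theta> div 2 ^ k"
      using Suc.prems(4) unfolding kk by (simp add: div_mult2_eq)
    ultimately have 1: "measure_pmf.prob (search \<tau> s (Suc e) (a div 2)) ?S \<le> u"
      using Suc.IH[of "Suc e" k "a div 2"] e ek by (simp add: u_def)
    have p4: "2 ^ (2 * k - e') * (3 / 4) ^ s / 2 ^ W = 4 * u"
    proof -
      have "2 * k - e' = Suc (Suc (2 * k - Suc e))" using ek e by auto
      then show ?thesis by (simp add: u_def)
    qed
    \<comment> \<open>Both children end at or before \<theta> and have the same ancestor at level
      \<open>k\<close>, so the answer of the second test does not affect the bound.\<close>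
    have 2: "measure_pmf.prob (search \<tau> s e' (if b' then 2 * a else 2 * a + 1)) ?S \<le> 4 * u" for b'
    proof -
      have "(if b' then 2 * a else 2 * a + 1) div 2 = a" by simp
      then have "(if b' then 2 * a else 2 * a + 1) div 2 ^ (k - e') = \<theta> div 2 ^ k"
        unfolding Suc.prems(4)[symmetric] kk(2) power_Suc div_mult2_eq by simp
      moreover have "(if b' then 2 * a else 2 * a + 1) * 2 ^ e' \<le> (a + 1) * 2 ^ e"
        by (simp add: e algebra_simps)
      then have "(if b' then 2 * a else 2 * a + 1) * 2 ^ e' \<le> \<theta>"
        using False by linarith
      ultimately show ?thesis
        using Suc.IH[of e' k "if b' then 2 * a else 2 * a + 1"] e ek p4 by simp
    qed
    define r where "r = bind_pmf (\<tau> ((2 * a + 1) * 2 ^ (e - 1) - 1))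
       (\<lambda>b'. search \<tau> s (e - 1) (if b' then 2 * a else 2 * a + 1))"
    have 3: "measure_pmf.prob r ?S \<le> 4 * u"
      unfolding r_def prob_bind_bool using 2[of True] 2[of False] e
      by (intro convex_bound_bool) (auto simp: pmf_le_1)
    have "pmf (\<tau> m) True * measure_pmf.prob r ?S \<le> pmf (\<tau> m) True * (4 * u)"
      by (intro mult_left_mono 3) auto
    moreover have "(1 - pmf (\<tau> m) True) * measure_pmf.prob (search \<tau> s (Suc e) (a div 2)) ?S
        \<le> (1 - pmf (\<tau> m) True) * u"
      by (intro mult_left_mono 1) (auto simp: pmf_le_1)
    moreover have "pmf (\<tau> m) True * (3 * u) \<le> 1 / 8 * (3 * u)"
      using below[OF \<open>m < \<theta>\<close>] u0 by (intro mult_right_mono) auto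
    moreover have "measure_pmf.prob (search \<tau> (Suc s) e a) ?S = pmf (\<tau> m) True * measure_pmf.prob r ?S +
        (1 - pmf (\<tau> m) True) * measure_pmf.prob (search \<tau> s (Suc e) (a div 2)) ?S"
      by (simp only: search.simps prob_bind_bool m_def r_def if_True if_False)
    ultimately have "measure_pmf.prob (search \<tau> (Suc s) e a) ?S \<le> 3 / 2 * u"
      using u0 by (simp add: algebra_simps del: search.simps)
    moreover have "2 ^ (2 * k - e) * (3 / 4) ^ Suc s / 2 ^ W = 3 / 2 * u"
    proof -
      have "2 * k - e = Suc (2 * k - Suc e)" using ek by auto
      then show ?thesis by (simp add: u_def)
    qed
    ultimately show ?thesis by linarith
  qed
qed

text \<open>A step makes at most two tests; the retreat makes one, and its cost is padded so that
  both branches obey the same bound.\<close>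

lemma computes_search:
  assumes "\<And>j. computes A B c (\<lambda>x y. \<tau> x y j)"
  shows "computes A B (2 * c * s) (\<lambda>x y. search (\<tau> x y) s e a)"
proof (induction s arbitrary: e a)
  case 0
  then show ?case by (simp add: computes_return)
next
  case (Suc s)
  define K where "K b x y = (if b then bind_pmf (\<tau> x y ((2 * a + 1) * 2 ^ (e - 1) - 1))
       (\<lambda>b'. search (\<tau> x y) s (e - 1) (if b' then 2 * a else 2 * a + 1))
     else search (\<tau> x y) s (Suc e) (a div 2))" for b x y
  have "computes A B (c + 2 * c * s) (K b)" for b
  proof (cases b)
    case True
    then show ?thesis
      using computes_bind[OF assms Suc.IH] by (simp add: K_def[abs_def])
  next
    case False
    then show ?thesis
      using computes_mono[OF Suc.IH, of "c + 2 * c * s"] by (simp add: K_def[abs_def])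
  qed
  from computes_bind[OF assms this] show ?case
    by (simp add: K_def algebra_simps)
qed

text \<open>The search looks for the least \<open>t\<close> such that \<open>x\<close> and \<open>y\<close> agree above the last \<open>t\<close> bits. It is
  run on the thresholds \<open>t 2\<^sup>W\<close>, so that it cannot reach level \<open>0\<close> before the steps are used up.\<close>

definition gt_test :: "nat \<Rightarrow> nat \<Rightarrow> nat \<Rightarrow> nat \<Rightarrow> nat \<Rightarrow> bool pmf" where
  "gt_test n L d x y = (let T = 3 * (L + d); W = T - L in
     bind_pmf (search (\<lambda>j. eq_test {..<2 ^ n} 3 (x div 2 ^ (j div 2 ^ W)) (y div 2 ^ (j div 2 ^ W))) T T 0)
       (\<lambda>v. return_pmf (v div 2 ^ W = 0 \<or> odd (x div 2 ^ (v div 2 ^ W - 1)))))"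

lemma computes_gt_test: "computes A B (36 * (L + d) + 1) (gt_test n L d)"
proof -
  \<comment> \<open>Three rounds of hashing cost 6 bits per test, there are two tests per step, and
    in the end Alice announces one bit of \<open>x\<close>.\<close>
  have "computes A B (2 * 6 * (3 * (L + d)) + 1) (gt_test n L d)"
    unfolding gt_test_def Let_def
    by (intro computes_bind computes_search computes_Alice
        computes_comap[OF computes_eq_test[of UNIV UNIV 3, simplified]]) auto
  then show ?thesis by (simp add: algebra_simps)
qed

text \<open>If \<open>t > 0\<close>, then all bits from position \<open>t\<close> upwards agree and
  the bits at position \<open>t - 1\<close> differ, so this bit of \<open>x\<close> decides the
  comparison. If \<open>t = 0\<close>, then \<open>x = y\<close>.\<close>

lemma ge_iff_odd_at_first_difference:
  fixes x y :: nat
  defines "t \<equiv> LEAST j. x div 2 ^ j = y div 2 ^ j"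
  assumes "x div 2 ^ n = y div 2 ^ n"
  shows "t = 0 \<or> odd (x div 2 ^ (t - 1)) \<longleftrightarrow> y \<le> x"
proof -
  have t: "x div 2 ^ t = y div 2 ^ t"
    unfolding t_def using assms(2) by (rule LeastI)
  show ?thesis
  proof (cases t)
    case 0
    then show ?thesis using t by simp
  next
    case (Suc s)
    define x' y' where "x' = x div 2 ^ s" and "y' = y div 2 ^ s"
    have "x' \<noteq> y'"
      using not_less_Least[of s "\<lambda>j. x div 2 ^ j = y div 2 ^ j"] Suc
      by (simp add: x'_def y'_def t_def)
    moreover have "x' div 2 = y' div 2"
      using t by (simp add: Suc x'_def y'_def power_Suc2 div_mult2_eq del: power_Suc)
    moreover have "x' < y' \<Longrightarrow> x < y" "y' < x' \<Longrightarrow> y < x"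
      unfolding x'_def y'_def by (meson div_le_mono not_le)+
    ultimately have "odd x' \<longleftrightarrow> y \<le> x"
      by (metis dvd_mult_div_cancel linorder_neqE_nat not_le odd_two_times_div_two_succ
          less_imp_le_nat less_add_one)
    then show ?thesis using Suc by (simp add: x'_def)
  qed
qed

text \<open>Prefixes agree exactly for shifts of at least \<open>t\<close>, and three rounds of
  hashing miss a difference with probability \<open>1 / 8\<close>. Thus \<open>search_error\<close>
  applies with threshold \<open>t * 2 ^ W\<close>, which lies in the root interval of length
  \<open>2 ^ T\<close> because \<open>t \<le> n < 2 ^ L\<close>.\<close>

lemma gt_test_error:
  assumes "x < 2 ^ n" "y < 2 ^ n" "n < 2 ^ L"
  shows "measure_pmf.prob (gt_test n L d x y) {b. b \<noteq> (y \<le> x)} \<le> (1 / 2) ^ d"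
proof -
  define T W where "T = 3 * (L + d)" and "W = T - L"
  define t where "t = (LEAST j. x div 2 ^ j = y div 2 ^ j)"
  define \<tau> where "\<tau> j = eq_test {..<2 ^ n} 3 (x div 2 ^ (j div 2 ^ W)) (y div 2 ^ (j div 2 ^ W))" for j
  have n: "x div 2 ^ n = y div 2 ^ n"
    using assms by simp
  have t: "x div 2 ^ t = y div 2 ^ t"
    unfolding t_def using n by (rule LeastI)
  have agree: "x div 2 ^ j = y div 2 ^ j" if "t \<le> j" for j
  proof -
    have "(2::nat) ^ j = 2 ^ t * 2 ^ (j - t)"
      using that by (simp flip: power_add)
    then show ?thesis using t by (simp add: div_mult2_eq)
  qed
  have differ: "x div 2 ^ j \<noteq> y div 2 ^ j" if "j < t" for j
    using that unfolding t_def by (rule not_less_Least)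
  have "t \<le> n"
    unfolding t_def using n by (rule Least_le)
  have "measure_pmf.prob (search \<tau> T T 0) {v. v div 2 ^ W \<noteq> t * 2 ^ W div 2 ^ W}
      \<le> 2 ^ (2 * T - T) * (3 / 4) ^ T / 2 ^ W"
  proof (rule search_error)
    fix j
    assume "t * 2 ^ W \<le> j"
    then have "t \<le> j div 2 ^ W"
      by (simp add: less_eq_div_iff_mult_less_eq)
    then show "\<tau> j = return_pmf True"
      unfolding \<tau>_def by (simp add: agree eq_test_refl)
  next
    fix j
    assume "j < t * 2 ^ W"
    then have "j div 2 ^ W < t"
      by (simp add: less_mult_imp_div_less)
    moreover have "x div 2 ^ (j div 2 ^ W) < 2 ^ n"
      using assms(1) by (meson div_le_dividend le_less_trans)
    ultimately have "pmf (\<tau> j) True = (1 / 2) ^ 3"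
      unfolding \<tau>_def by (intro eq_test_neq differ) auto
    then show "pmf (\<tau> j) True \<le> 1 / 8"
      by (simp add: power3_eq_cube)
  next
    have "t * 2 ^ W < 2 ^ L * 2 ^ W"
      using \<open>t \<le> n\<close> assms(3) by (intro mult_strict_right_mono) auto
    also have "\<dots> = 2 ^ T"
      by (simp add: W_def T_def flip: power_add)
    finally show "0 div 2 ^ (T - T) = t * 2 ^ W div 2 ^ T"
      by simp
  qed auto
  also have "2 ^ (2 * T - T) * (3 / 4) ^ T / 2 ^ W = (2::real) ^ L * (3 / 4) ^ T"
  proof -
    have "2 * T - T = L + W" by (simp add: T_def W_def)
    then show ?thesis by (simp add: power_add)
  qed
  \<comment> \<open>The factor 3 in \<open>T\<close> is chosen so that
    \<open>(3 / 4) ^ 3 = 27 / 64\<close> is below \<open>1 / 2\<close>; the \<open>L\<close> extra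
    factors absorb \<open>2 ^ L\<close>.\<close>
  also have "(3 / 4 :: real) ^ T = (27 / 64) ^ (L + d)"
    unfolding T_def power_mult by (rule arg_cong[of _ _ "\<lambda>r. r ^ (L + d)"]) (simp add: power3_eq_cube)
  also have "2 ^ L * (27 / 64) ^ (L + d) \<le> 2 ^ L * (1 / 2 :: real) ^ (L + d)"
    by (intro mult_left_mono power_mono) auto
  also have "\<dots> = (1 / 2) ^ d"
    by (simp add: power_add power_one_over)
  finally have *: "measure_pmf.prob (search \<tau> T T 0) {v. v div 2 ^ W \<noteq> t} \<le> (1 / 2) ^ d"
    by simp
  have "gt_test n L d x y = map_pmf (\<lambda>v. v div 2 ^ W = 0 \<or> odd (x div 2 ^ (v div 2 ^ W - 1))) (search \<tau> T T 0)"
    by (simp add: gt_test_def Let_def map_pmf_def W_def T_def \<tau>_def[abs_def])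
  moreover have "t = 0 \<or> odd (x div 2 ^ (t - 1)) \<longleftrightarrow> y \<le> x"
    unfolding t_def using n by (rule ge_iff_odd_at_first_difference)
  ultimately have "measure_pmf.prob (gt_test n L d x y) {b. b \<noteq> (y \<le> x)}
      \<le> measure_pmf.prob (search \<tau> T T 0) {v. v div 2 ^ W \<noteq> t}"
    by (auto simp: vimage_def intro!: measure_pmf.finite_measure_mono)
  with * show ?thesis by linarith
qed

section \<open>Quantiles\<close>

definition quantile :: "nat \<Rightarrow> nat pmf \<Rightarrow> nat \<Rightarrow> nat" where
  "quantile N P a = (LEAST z. real a / real N \<le> measure_pmf.prob P {..z})"

context
  fixes N M :: nat and P :: "nat pmf"
  assumes N: "N > 0" and P: "set_pmf P \<subseteq> {..<M}"
begin

lemma quantile_exists: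
  assumes "a \<le> N"
  shows "real a / real N \<le> measure_pmf.prob P {..M - 1}" "M > 0"
proof -
  show "M > 0"
    using P set_pmf_not_empty[of P] by auto
  have "measure_pmf.prob P {..M - 1} = 1"
    using P by (subst measure_pmf.prob_eq_1) (auto simp: AE_measure_pmf_iff)
  then show "real a / real N \<le> measure_pmf.prob P {..M - 1}"
    using assms N by simp
qed

text \<open>The Galois connection between quantiles and the distribution function, from which the
  other properties of \<open>quantile\<close> are derived.\<close>

lemma quantile_le_iff:
  assumes "a \<le> N"
  shows "quantile N P a \<le> z \<longleftrightarrow> real a / real N \<le> measure_pmf.prob P {..z}"
proof
  assume "quantile N P a \<le> z"
  have "real a / real N \<le> measure_pmf.prob P {..quantile N P a}"
    unfolding quantile_def using quantile_exists(1)[OF assms] by (rule LeastI)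
  also have "\<dots> \<le> measure_pmf.prob P {..z}"
    using \<open>quantile N P a \<le> z\<close> by (intro measure_pmf.finite_measure_mono) auto
  finally show "real a / real N \<le> measure_pmf.prob P {..z}" .
qed (simp add: quantile_def Least_le)

lemma quantile_less: "a \<le> N \<Longrightarrow> quantile N P a < M"
  using quantile_le_iff[of a "M - 1"] quantile_exists[of a] by (cases M) auto

lemma quantile_mono:
  assumes "a \<le> b" "b \<le> N"
  shows "quantile N P a \<le> quantile N P b"
proof -
  have "real a / real N \<le> real b / real N"
    using assms by (simp add: divide_right_mono)
  also have "\<dots> \<le> measure_pmf.prob P {..quantile N P b}"
    using quantile_le_iff[OF assms(2)] by auto
  finally show ?thesis
    using quantile_le_iff assms by simp
qed

lemma quantile_count_le:
  "\<bar>(\<Sum>a<N. of_bool (quantile N P a \<le> z)) / real N - measure_pmf.prob P {..z}\<bar> \<le> 1 / real N"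
proof -
  define w where "w = measure_pmf.prob P {..z}"
  have w: "0 \<le> w" "w \<le> 1" by (simp_all add: w_def)
  have "(\<Sum>a<N. of_bool (quantile N P a \<le> z) :: real) = card {a \<in> {..<N}. quantile N P a \<le> z}"
    by (simp add: of_bool_def sum.If_cases Int_def)
  \<comment> \<open>The condition on \<open>a\<close> becomes \<open>a \<le> w * N\<close>. Counting
    from \<open>a = 0\<close> gives the floor plus one, capped at \<open>N\<close>, which is within
    1 of \<open>w * N\<close>.\<close>
  also have "{a \<in> {..<N}. quantile N P a \<le> z} = {..<min N (Suc (nat \<lfloor>w * real N\<rfloor>))}"
  proof -
    have "quantile N P a \<le> z \<longleftrightarrow> a < Suc (nat \<lfloor>w * real N\<rfloor>)" if "a < N" for a
    proof -
      have "quantile N P a \<le> z \<longleftrightarrow> real a \<le> w * real N"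
        using that N by (simp add: quantile_le_iff w_def divide_le_eq)
      also have "\<dots> \<longleftrightarrow> a \<le> nat \<lfloor>w * real N\<rfloor>"
        using w by (simp add: le_nat_floor le_nat_iff le_floor_iff)
      finally show ?thesis by (simp add: less_Suc_eq_le)
    qed
    then show ?thesis by auto
  qed
  also have "real (card {..<min N (Suc (nat \<lfloor>w * real N\<rfloor>))}) = min (real N) (real_of_int \<lfloor>w * real N\<rfloor> + 1)"
    unfolding card_lessThan of_nat_min using w by simp
  finally have *: "(\<Sum>a<N. of_bool (quantile N P a \<le> z) :: real) = min (real N) (real_of_int \<lfloor>w * real N\<rfloor> + 1)" .
  have "w * real N \<le> 1 * real N"
    using w by (intro mult_right_mono) auto
  then have "\<bar>min (real N) (real_of_int \<lfloor>w * real N\<rfloor> + 1) - w * real N\<bar> \<le> 1"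
    by linarith
  then have "\<bar>min (real N) (real_of_int \<lfloor>w * real N\<rfloor> + 1) - w * real N\<bar> / real N \<le> 1 / real N"
    using N by (intro divide_right_mono) auto
  moreover have "min (real N) (real_of_int \<lfloor>w * real N\<rfloor> + 1) / real N - w =
      (min (real N) (real_of_int \<lfloor>w * real N\<rfloor> + 1) - w * real N) / real N"
    using N by (simp add: field_simps)
  ultimately show ?thesis
    unfolding * w_def[symmetric] by simp
qed

lemma quantile_count_ge:
  "\<bar>(\<Sum>a<N. of_bool (z \<le> quantile N P a)) / real N - measure_pmf.prob P {z..}\<bar> \<le> 1 / real N"
proof (cases z)
  case 0
  then show ?thesis using N by (simp add: measure_pmf.prob_space)
next
  case (Suc y)
  have "(\<Sum>a<N. of_bool (z \<le> quantile N P a) :: real) = (\<Sum>a<N. 1 - of_bool (quantile N P a \<le> y))"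
    by (intro sum.cong) (auto simp: Suc)
  then have 1: "(\<Sum>a<N. of_bool (z \<le> quantile N P a) :: real) / real N =
      1 - (\<Sum>a<N. of_bool (quantile N P a \<le> y)) / real N"
    using N by (simp add: sum_subtractf field_simps)
  have "{z..} = UNIV - {..y}"
    by (auto simp: Suc)
  then have "measure_pmf.prob P {z..} = 1 - measure_pmf.prob P {..y}"
    using measure_pmf.prob_compl[of "{..y}" P] by simp
  then show ?thesis
    using quantile_count_le[of y] 1 by linarith
qed

end

lemma abs_divide_of_nat: "\<bar>x\<bar> / real N = \<bar>x / real N\<bar>"
  by simp

text \<open>The distributions are replaced one at a time. The hybrid \<open>S\<close> uses the grid
  for \<open>Q\<close> but still the exact \<open>P\<close>, and each replacement costs at most
  \<open>1 / N\<close>.\<close>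

lemma quantile_grid_bias:
  assumes "N > 0" "set_pmf P \<subseteq> {..<M}" "set_pmf Q \<subseteq> {..<M}"
  shows "\<bar>(\<Sum>a<N. \<Sum>b<N. of_bool (quantile N Q b \<le> quantile N P a)) / (real N)\<^sup>2
    - measure_pmf.expectation P (\<lambda>x. measure_pmf.prob Q {..x})\<bar> \<le> 2 / real N"
proof -
  have fin: "finite (set_pmf P)"
    using assms(2) finite_subset by blast
  note int = integrable_measure_pmf_finite[OF fin]
  define S where "S = (\<Sum>b<N. measure_pmf.prob P {quantile N Q b..}) / real N"
  have S: "S = measure_pmf.expectation P (\<lambda>x. (\<Sum>b<N. of_bool (quantile N Q b \<le> x)) / real N)"
  proof -
    have "measure_pmf.expectation P (\<lambda>x. of_bool (z \<le> x)) = measure_pmf.prob P {z..}" for z :: nat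
    proof -
      have "(\<lambda>x. of_bool (z \<le> x) :: real) = indicator {z..}"
        by (auto simp: indicator_def)
      then show ?thesis by simp
    qed
    then show ?thesis
      by (subst integral_divide_zero, subst Bochner_Integration.integral_sum)
        (auto simp: S_def int simp del: sum_of_bool_eq)
  qed
  have "\<bar>S - measure_pmf.expectation P (\<lambda>x. measure_pmf.prob Q {..x})\<bar>
      = \<bar>measure_pmf.expectation P (\<lambda>x. (\<Sum>b<N. of_bool (quantile N Q b \<le> x)) / real N
          - measure_pmf.prob Q {..x})\<bar>"
    unfolding S by (subst Bochner_Integration.integral_diff) (auto simp: int)
  also have "\<dots> \<le> measure_pmf.expectation P (\<lambda>x. \<bar>(\<Sum>b<N. of_bool (quantile N Q b \<le> x)) / real N
          - measure_pmf.prob Q {..x}\<bar>)"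
    by (rule integral_abs_bound)
  also have "\<dots> \<le> measure_pmf.expectation P (\<lambda>x. 1 / real N)"
    using quantile_count_le[OF assms(1,3)] by (intro integral_mono int) auto
  finally have 1: "\<bar>S - measure_pmf.expectation P (\<lambda>x. measure_pmf.prob Q {..x})\<bar> \<le> 1 / real N"
    by simp
  have "\<bar>(\<Sum>a<N. \<Sum>b<N. of_bool (quantile N Q b \<le> quantile N P a)) / (real N)\<^sup>2 - S\<bar> =
    \<bar>\<Sum>b<N. ((\<Sum>a<N. of_bool (quantile N Q b \<le> quantile N P a)) / real N
        - measure_pmf.prob P {quantile N Q b..})\<bar> / real N"
    by (subst sum.swap, subst abs_divide_of_nat) (simp add: S_def sum_subtractf power2_eq_square
        diff_divide_distrib flip: sum_divide_distrib)
  also have "\<dots> \<le> (\<Sum>b<N. 1 / real N) / real N"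
    by (intro divide_right_mono order_trans[OF sum_abs] sum_mono quantile_count_ge[OF assms(1,2)]) auto
  finally have "\<bar>(\<Sum>a<N. \<Sum>b<N. of_bool (quantile N Q b \<le> quantile N P a)) / (real N)\<^sup>2 - S\<bar> \<le> 1 / real N"
    using assms(1) by simp
  with 1 show ?thesis by linarith
qed

section \<open>The mean of greater-than in terms of distributions on the naturals\<close>

lemma bits_val_less: "x \<in> cube n \<Longrightarrow> bits_val x < 2 ^ n"
  using horner_sum_of_bool_2_less[of "rev x", where ?'a = nat]
  by (simp add: bits_val_def cube_def)

lemma mean_value_greater_than:
  "mean_value greater_than p q = measure_pmf.expectation (map_pmf bits_val p)
     (\<lambda>x. measure_pmf.prob (map_pmf bits_val q) {..x})"
proof -
  have "mean_value greater_than p q =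
      measure_pmf.expectation (pair_pmf p q) (indicator {(x, y). bits_val y \<le> bits_val x})"
    unfolding mean_value_def
    by (intro Bochner_Integration.integral_cong) (auto simp: greater_than_def indicator_def)
  also have "\<dots> = measure_pmf.prob (pair_pmf p q) {(x, y). bits_val y \<le> bits_val x}"
    by simp
  also have "\<dots> = measure_pmf.expectation p (\<lambda>x. measure_pmf.prob q {y. bits_val y \<le> bits_val x})"
    by (simp add: pair_pmf_def measure_bind_pmf vimage_def flip: map_pmf_def)
  finally show ?thesis
    by (simp add: vimage_def)
qed

section \<open>Walk along the staircase\<close>

text \<open>The state \<open>(i, j)\<close> means that the blocks \<open>[i, m) \<times> [j, m)\<close> remain to be estimated. If the
  upper corner of block \<open>(i, j)\<close> satisfies \<open>X \<ge> Y\<close>, then the blocks \<open>(i', j)\<close> with \<open>i' > i\<close> are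
  constantly \<open>1\<close>; otherwise the blocks \<open>(i, j')\<close> with \<open>j' > j\<close> are constantly \<open>0\<close>.\<close>

primrec walk ::
  "(nat \<Rightarrow> nat \<Rightarrow> bool pmf) \<Rightarrow> nat \<Rightarrow> nat \<Rightarrow> (nat \<Rightarrow> nat) \<Rightarrow> (nat \<Rightarrow> nat) \<Rightarrow> nat \<Rightarrow> nat \<Rightarrow> nat \<Rightarrow> real pmf"
where
  "walk G m l X Y 0 i j = return_pmf 0"
| "walk G m l X Y (Suc s) i j = (if m \<le> i \<or> m \<le> j then return_pmf 0 else
     bind_pmf (pmf_of_set ({i * l..<i * l + l} \<times> {j * l..<j * l + l})) (\<lambda>r.
     bind_pmf (G (X (fst r)) (Y (snd r))) (\<lambda>g.
     bind_pmf (G (X (Suc i * l)) (Y (Suc j * l))) (\<lambda>c.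
     map_pmf (\<lambda>z. z + (of_bool g + (if c then real (m - Suc i) else 0)))
       (if c then walk G m l X Y s i (Suc j) else walk G m l X Y s (Suc i) j)))))"

text \<open>The sample point is shared randomness and the position \<open>(i, j)\<close> follows
  from the transcript, so only the two comparisons in each step cost bits.\<close>

lemma computes_walk:
  assumes "\<And>a b. computes A B c (\<lambda>p q. G (X p a) (Y q b))"
  shows "computes A B (2 * c * s) (\<lambda>p q. walk G m l (X p) (Y q) s i j)"
proof (induction s arbitrary: i j)
  case 0
  then show ?case by (simp add: computes_return)
next
  case (Suc s)
  show ?case
  proof (cases "m \<le> i \<or> m \<le> j")
    case True
    then show ?thesis by (simp add: computes_return)
  next
    case False
    have "computes A B (2 * c * s + 0) (\<lambda>p q. bind_pmf
        (if v then walk G m l (X p) (Y q) s i (Suc j) else walk G m l (X p) (Y q) s (Suc i) j)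
        (\<lambda>z. return_pmf (z + (of_bool g + (if v then real (m - Suc i) else 0)))))" for g v
      using Suc.IH by (intro computes_bind computes_return) (cases v; simp)
    then have "computes A B (c + (c + (2 * c * s + 0))) (\<lambda>p q.
      bind_pmf (pmf_of_set ({i * l..<i * l + l} \<times> {j * l..<j * l + l})) (\<lambda>r.
      bind_pmf (G (X p (fst r)) (Y q (snd r))) (\<lambda>g.
      bind_pmf (G (X p (Suc i * l)) (Y q (Suc j * l))) (\<lambda>v.
      bind_pmf (if v then walk G m l (X p) (Y q) s i (Suc j) else walk G m l (X p) (Y q) s (Suc i) j)
        (\<lambda>z. return_pmf (z + (of_bool g + (if v then real (m - Suc i) else 0))))))))"
      by (intro computes_shared computes_bind[where c = c] assms)
    then show ?thesis
      using False by (simp add: map_pmf_def algebra_simps)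
  qed
qed

section \<open>Effect of noisy comparisons on the walk\<close>

lemma prob_bind_noisy_bool:
  fixes p :: "bool pmf"
  assumes "measure_pmf.prob p {b. b \<noteq> v} \<le> \<delta>"
  shows "measure_pmf.prob (f v) S - \<delta> \<le> measure_pmf.prob (bind_pmf p f) S"
proof -
  define A where "A b = measure_pmf.prob (f b) S" for b
  have A: "0 \<le> A b" "A b \<le> 1" for b by (simp_all add: A_def)
  have "{b. b \<noteq> v} = {\<not> v}" by auto
  then have 1: "pmf p (\<not> v) \<le> \<delta>" using assms by (simp add: measure_pmf_single)
  have "pmf p (\<not> v) * A v \<le> \<delta> * 1"
    using A[of v] 1 by (intro mult_mono) (auto intro: order_trans[OF pmf_nonneg])
  moreover have "0 \<le> pmf p (\<not> v) * A (\<not> v)" using A by simp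
  moreover have "measure_pmf.prob (bind_pmf p f) S = (1 - pmf p (\<not> v)) * A v + pmf p (\<not> v) * A (\<not> v)"
    by (cases v) (simp_all add: prob_bind_bool A_def pmf_False)
  ultimately show ?thesis unfolding A_def[symmetric] by (simp add: algebra_simps)
qed

lemma prob_bind_diff_le:
  assumes "\<And>x. x \<in> set_pmf R \<Longrightarrow> measure_pmf.prob (g x) S - \<eta> \<le> measure_pmf.prob (f x) S"
  shows "measure_pmf.prob (bind_pmf R g) S - \<eta> \<le> measure_pmf.prob (bind_pmf R f) S"
proof -
  have int: "integrable R (\<lambda>x. measure_pmf.prob (h x) S)" for h :: "'a \<Rightarrow> 'b pmf"
    by (intro measure_pmf.integrable_const_bound[where B=1]) auto
  have "measure_pmf.expectation R (\<lambda>x. measure_pmf.prob (g x) S - \<eta>)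
      \<le> measure_pmf.expectation R (\<lambda>x. measure_pmf.prob (f x) S)"
    using assms by (intro integral_mono_AE Bochner_Integration.integrable_diff int)
      (auto simp: AE_measure_pmf_iff)
  then show ?thesis
    by (simp add: measure_bind_pmf Bochner_Integration.integral_diff int)
qed

abbreviation exact_gt :: "nat \<Rightarrow> nat \<Rightarrow> bool pmf" where
  "exact_gt x y \<equiv> return_pmf (y \<le> x)"

text \<open>A union bound over the at most \<open>2 * s\<close> comparisons, replacing one noisy bit
  at a time by its intended value.\<close>

lemma walk_noise:
  assumes "\<And>a b. a \<le> m * l \<Longrightarrow> b \<le> m * l \<Longrightarrow>
    measure_pmf.prob (G (X a) (Y b)) {v. v \<noteq> (Y b \<le> X a)} \<le> \<delta>"
    and "\<delta> \<ge> 0" "l > 0"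
  shows "measure_pmf.prob (walk exact_gt m l X Y s i j) S - 2 * real s * \<delta>
    \<le> measure_pmf.prob (walk G m l X Y s i j) S"
proof (induction s arbitrary: i j S)
  case (Suc s)
  show ?case
  proof (cases "m \<le> i \<or> m \<le> j")
    case True
    then show ?thesis using assms(2) by simp
  next
    case False
    \<comment> \<open>The corner of a last block has index \<open>m * l\<close>, one past the
      sampled indices, so the noise bound has to cover this index too.\<close>
    then have corner: "Suc i * l \<le> m * l" "Suc j * l \<le> m * l"
      by (intro mult_right_mono; simp)+
    define F where "F H g c = map_pmf (\<lambda>z. z + (of_bool g + (if c then real (m - Suc i) else 0)))
       (if c then walk H m l X Y s i (Suc j) else walk H m l X Y s (Suc i) j)"
      for H :: "nat \<Rightarrow> nat \<Rightarrow> bool pmf" and g c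
    define c where "c = (Y (Suc j * l) \<le> X (Suc i * l))"
    have F: "measure_pmf.prob (F exact_gt g c) S - 2 * real s * \<delta> \<le> measure_pmf.prob (F G g c) S" for g c
      by (simp add: F_def Suc.IH)
    have "measure_pmf.prob (bind_pmf (exact_gt (X a) (Y b)) (\<lambda>g. F exact_gt g c)) S - 2 * real (Suc s) * \<delta>
      \<le> measure_pmf.prob (bind_pmf (G (X a) (Y b)) (\<lambda>g. bind_pmf (G (X (Suc i * l)) (Y (Suc j * l))) (F G g))) S"
      if "a < Suc i * l" "b < Suc j * l" for a b
    proof -
      have "measure_pmf.prob (F exact_gt (Y b \<le> X a) c) S - 2 * real s * \<delta> \<le> measure_pmf.prob (F G (Y b \<le> X a) c) S"
        by (rule F)
      moreover have "measure_pmf.prob (F G (Y b \<le> X a) c) S - \<delta>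
          \<le> measure_pmf.prob (bind_pmf (G (X (Suc i * l)) (Y (Suc j * l))) (F G (Y b \<le> X a))) S"
        unfolding c_def by (intro prob_bind_noisy_bool assms corner)
      moreover have "measure_pmf.prob (bind_pmf (G (X (Suc i * l)) (Y (Suc j * l))) (F G (Y b \<le> X a))) S - \<delta>
          \<le> measure_pmf.prob (bind_pmf (G (X a) (Y b)) (\<lambda>g. bind_pmf (G (X (Suc i * l)) (Y (Suc j * l))) (F G g))) S"
        using that corner
        by (intro prob_bind_noisy_bool[where f = "\<lambda>g. bind_pmf _ (F G g)"] assms) linarith+
      ultimately show ?thesis
        by (simp add: bind_return_pmf algebra_simps)
    qed
    moreover have "walk exact_gt m l X Y (Suc s) i j =
       bind_pmf (pmf_of_set ({i * l..<i * l + l} \<times> {j * l..<j * l + l}))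
         (\<lambda>r. bind_pmf (exact_gt (X (fst r)) (Y (snd r))) (\<lambda>g. F exact_gt g c))"
      using False by (simp add: F_def c_def bind_return_pmf)
    moreover have "walk G m l X Y (Suc s) i j =
       bind_pmf (pmf_of_set ({i * l..<i * l + l} \<times> {j * l..<j * l + l}))
         (\<lambda>r. bind_pmf (G (X (fst r)) (Y (snd r))) (\<lambda>g. bind_pmf (G (X (Suc i * l)) (Y (Suc j * l))) (F G g)))"
      using False by (simp add: F_def[abs_def])
    ultimately show ?thesis
      using assms(3) by (simp only:) (rule prob_bind_diff_le, auto simp: add.commute)
  qed
qed simp

section \<open>Block averages, and the second moment of the walk with exact comparisons\<close>

definition block_mean :: "nat \<Rightarrow> (nat \<Rightarrow> nat) \<Rightarrow> (nat \<Rightarrow> nat) \<Rightarrow> nat \<Rightarrow> nat \<Rightarrow> real" where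
  "block_mean l X Y i j =
     (\<Sum>a\<in>{i * l..<i * l + l}. \<Sum>b\<in>{j * l..<j * l + l}. of_bool (Y b \<le> X a)) / (real l)\<^sup>2"

definition block_total :: "nat \<Rightarrow> nat \<Rightarrow> (nat \<Rightarrow> nat) \<Rightarrow> (nat \<Rightarrow> nat) \<Rightarrow> nat \<Rightarrow> nat \<Rightarrow> real" where
  "block_total m l X Y i j = (\<Sum>i'\<in>{i..<m}. \<Sum>j'\<in>{j..<m}. block_mean l X Y i' j')"

lemma block_total_0_0:
  "block_total m l X Y 0 0 = (\<Sum>a<m * l. \<Sum>b<m * l. of_bool (Y b \<le> X a)) / (real l)\<^sup>2"
proof -
  have "(\<Sum>a<m * l. \<Sum>b<m * l. of_bool (Y b \<le> X a) :: real) =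
    (\<Sum>i<m. \<Sum>a\<in>{i * l..<i * l + l}. \<Sum>j<m. \<Sum>b\<in>{j * l..<j * l + l}. of_bool (Y b \<le> X a))"
    unfolding sum.nat_group ..
  also have "\<dots> = (\<Sum>i<m. \<Sum>j<m. \<Sum>a\<in>{i * l..<i * l + l}. \<Sum>b\<in>{j * l..<j * l + l}. of_bool (Y b \<le> X a))"
    by (intro sum.cong refl sum.swap)
  finally show ?thesis
    unfolding block_total_def block_mean_def by (simp only: sum_divide_distrib atLeast0LessThan)
qed

lemma finite_set_walk: "l > 0 \<Longrightarrow> (\<And>x y. finite (set_pmf (G x y))) \<Longrightarrow> finite (set_pmf (walk G m l X Y s i j))"
  by (induction s arbitrary: i j) auto

lemma block_mean_bounds: "0 \<le> block_mean l X Y i j" "block_mean l X Y i j \<le> 1"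
proof -
  show "0 \<le> block_mean l X Y i j"
    unfolding block_mean_def by (intro divide_nonneg_nonneg sum_nonneg) auto
  have "(\<Sum>a\<in>{i * l..<i * l + l}. \<Sum>b\<in>{j * l..<j * l + l}. of_bool (Y b \<le> X a) :: real)
      \<le> (\<Sum>a\<in>{i * l..<i * l + l}. \<Sum>b\<in>{j * l..<j * l + l}. 1)"
    by (intro sum_mono) auto
  then show "block_mean l X Y i j \<le> 1"
    unfolding block_mean_def by (auto simp: divide_le_eq power2_eq_square simp del: sum_of_bool_eq)
qed

context
  fixes m l :: nat and X Y :: "nat \<Rightarrow> nat"
  assumes l: "l > 0"
    and monoX: "\<And>a b. a \<le> b \<Longrightarrow> b \<le> m * l \<Longrightarrow> X a \<le> X b"
    and monoY: "\<And>a b. a \<le> b \<Longrightarrow> b \<le> m * l \<Longrightarrow> Y a \<le> Y b"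
begin

text \<open>By monotonicity \<open>X a\<close> is at least \<open>X\<close> at the corner, which is
  at least \<open>Y\<close> at the corner, which is at least \<open>Y b\<close>.\<close>

lemma block_mean_eq_1:
  assumes "Y (Suc j * l) \<le> X (Suc i * l)" "i < i'" "i' < m" "j < m"
  shows "block_mean l X Y i' j = 1"
proof -
  have "Suc i * l \<le> i' * l" "Suc i' * l \<le> m * l" "Suc j * l \<le> m * l"
    using assms by (intro mult_right_mono; simp)+
  then have "Y b \<le> X a" if "i' * l \<le> a" "a < i' * l + l" "b < j * l + l" for a b
    using monoX[of "Suc i * l" a] monoY[of b "Suc j * l"] assms(1) that by force
  then have "(\<Sum>a\<in>{i' * l..<i' * l + l}. \<Sum>b\<in>{j * l..<j * l + l}. of_bool (Y b \<le> X a) :: real)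
      = (\<Sum>a\<in>{i' * l..<i' * l + l}. \<Sum>b\<in>{j * l..<j * l + l}. 1)"
    by (intro sum.cong) auto
  then show ?thesis
    using l by (simp add: block_mean_def power2_eq_square del: sum_of_bool_eq)
qed

lemma block_mean_eq_0:
  assumes "X (Suc i * l) < Y (Suc j * l)" "j < j'" "j' < m" "i < m"
  shows "block_mean l X Y i j' = 0"
proof -
  have "Suc j * l \<le> j' * l" "Suc j' * l \<le> m * l" "Suc i * l \<le> m * l"
    using assms by (intro mult_right_mono; simp)+
  then have "\<not> Y b \<le> X a" if "j' * l \<le> b" "b < j' * l + l" "a < i * l + l" for a b
    using monoX[of a "Suc i * l"] monoY[of "Suc j * l" b] assms(1) that by force
  then have "(\<Sum>a\<in>{i * l..<i * l + l}. \<Sum>b\<in>{j' * l..<j' * l + l}. of_bool (Y b \<le> X a) :: real)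
      = (\<Sum>a\<in>{i * l..<i * l + l}. \<Sum>b\<in>{j' * l..<j' * l + l}. 0)"
    by (intro sum.cong) auto
  then show ?thesis
    by (simp add: block_mean_def del: sum_of_bool_eq)
qed

text \<open>The corner comparison decides which line of blocks to split off: those with second index
  \<open>j\<close>, all 1 after the first block, or those with first index \<open>i\<close>, all 0
  after the first block.\<close>

lemma block_total_step:
  assumes "i < m" "j < m"
  shows "block_total m l X Y i j = block_mean l X Y i j +
    (if Y (Suc j * l) \<le> X (Suc i * l) then real (m - Suc i) + block_total m l X Y i (Suc j)
     else block_total m l X Y (Suc i) j)"
proof (cases "Y (Suc j * l) \<le> X (Suc i * l)")
  case True
  have "block_total m l X Y i j = (\<Sum>i'\<in>{i..<m}. block_mean l X Y i' j) + block_total m l X Y i (Suc j)"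
    using assms by (simp add: block_total_def sum.atLeast_Suc_lessThan sum.distrib)
  moreover have "(\<Sum>i'\<in>{i..<m}. block_mean l X Y i' j) = block_mean l X Y i j + (\<Sum>i'\<in>{Suc i..<m}. 1)"
    using assms block_mean_eq_1[OF True] by (simp add: sum.atLeast_Suc_lessThan)
  ultimately show ?thesis using True by simp
next
  case False
  have "block_total m l X Y i j = (\<Sum>j'\<in>{j..<m}. block_mean l X Y i j') + block_total m l X Y (Suc i) j"
    using assms by (simp add: block_total_def sum.atLeast_Suc_lessThan)
  moreover have "(\<Sum>j'\<in>{j..<m}. block_mean l X Y i j') = block_mean l X Y i j"
    using assms block_mean_eq_0[of i j] False by (simp add: sum.atLeast_Suc_lessThan)
  ultimately show ?thesis using False by simp
qed

text \<open>Stating the bound for all shifts \<open>c\<close> expresses at once that the estimate is unbiased and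
  that its variance is at most \<open>s\<close>.\<close>

lemma walk_second_moment:
  assumes "(m - i) + (m - j) \<le> s"
  shows "measure_pmf.expectation (walk exact_gt m l X Y s i j)
    (\<lambda>z. (z - block_total m l X Y i j + c)\<^sup>2) \<le> real s + c\<^sup>2"
  using assms
proof (induction s arbitrary: i j c)
  case 0
  then show ?case by (simp add: block_total_def)
next
  case (Suc s)
  show ?case
  proof (cases "m \<le> i \<or> m \<le> j")
    case True
    then show ?thesis by (auto simp: block_total_def)
  next
    case False
    define R where "R = {i * l..<i * l + l} \<times> {j * l..<j * l + l}"
    define \<mu> where "\<mu> = block_mean l X Y i j"
    define g where "g r = (of_bool (Y (snd r) \<le> X (fst r)) :: real)" for r
    define b where "b = (Y (Suc j * l) \<le> X (Suc i * l))"
    define K where "K = (if b then real (m - Suc i) else 0)"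
    define w where "w = (if b then walk exact_gt m l X Y s i (Suc j) else walk exact_gt m l X Y s (Suc i) j)"
    define V where "V = (if b then block_total m l X Y i (Suc j) else block_total m l X Y (Suc i) j)"
    have R: "finite R" "R \<noteq> {}" "card R = l * l"
      using l by (auto simp: R_def)
    have V: "block_total m l X Y i j = \<mu> + K + V"
      using block_total_step[of i j] False by (simp add: \<mu>_def K_def V_def b_def)
    have IH: "measure_pmf.expectation w (\<lambda>z. (z - V + c)\<^sup>2) \<le> real s + c\<^sup>2" for c
      using Suc.IH[of i "Suc j" c] Suc.IH[of "Suc i" j c] Suc.prems False by (auto simp: w_def V_def)
    have finw: "finite (set_pmf w)"
      using l by (simp add: w_def finite_set_walk)
    \<comment> \<open>With exact comparisons the corner bit is deterministic, so the rest
      \<open>w\<close> of the walk is independent of the sample \<open>r\<close>.\<close>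
    have walk: "walk exact_gt m l X Y (Suc s) i j =
        bind_pmf (pmf_of_set R) (\<lambda>r. map_pmf (\<lambda>z. z + (g r + K)) w)"
      using False by (simp add: R_def g_def K_def w_def b_def bind_return_pmf)
    have sum_g: "(\<Sum>r\<in>R. g r) = real (card R) * \<mu>"
      using l by (simp add: R(3) \<mu>_def block_mean_def R_def g_def sum.cartesian_product power2_eq_square
          case_prod_beta del: sum_of_bool_eq)
    have "measure_pmf.expectation (walk exact_gt m l X Y (Suc s) i j)
        (\<lambda>z. (z - block_total m l X Y i j + c)\<^sup>2)
      = (\<Sum>r\<in>R. measure_pmf.expectation w (\<lambda>z. (z - V + (g r - \<mu> + c))\<^sup>2)) / real (card R)"
      unfolding walk V
      by (subst pmf_expectation_bind_pmf_of_set)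
        (auto simp: R finw algebra_simps divide_inverse sum_distrib_left)
    \<comment> \<open>The induction hypothesis is applied with the shift
      \<open>g r - \<mu> + c\<close>. Its square contributes at most 1 from
      \<open>g r - \<mu>\<close> and a cross term that sums to 0 over \<open>R\<close>, as \<mu> is
      the mean of \<open>g\<close>.\<close>
    also have "\<dots> \<le> (\<Sum>r\<in>R. real s + 1 + 2 * c * (g r - \<mu>) + c\<^sup>2) / real (card R)"
    proof (intro divide_right_mono sum_mono)
      fix r
      have "\<bar>g r - \<mu>\<bar> \<le> 1"
        using block_mean_bounds[of l X Y i j] by (auto simp: g_def \<mu>_def)
      then have "(g r - \<mu>)\<^sup>2 \<le> 1"
        by (simp add: abs_square_le_1)
      moreover have "(g r - \<mu> + c)\<^sup>2 = (g r - \<mu>)\<^sup>2 + 2 * c * (g r - \<mu>) + c\<^sup>2"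
        by (simp add: power2_eq_square algebra_simps)
      ultimately show "measure_pmf.expectation w (\<lambda>z. (z - V + (g r - \<mu> + c))\<^sup>2)
          \<le> real s + 1 + 2 * c * (g r - \<mu>) + c\<^sup>2"
        using IH[of "g r - \<mu> + c"] by linarith
    qed simp
    also have "(\<Sum>r\<in>R. real s + 1 + 2 * c * (g r - \<mu>) + c\<^sup>2) = real (card R) * (real s + 1 + c\<^sup>2)"
    proof -
      have "(\<Sum>r\<in>R. 2 * c * (g r - \<mu>)) = 2 * c * (\<Sum>r\<in>R. g r - \<mu>)"
        by (simp only: sum_distrib_left)
      then show ?thesis
        by (simp add: sum.distrib sum_subtractf sum_g distrib_left)
    qed
    also have "\<dots> / real (card R) = real (Suc s) + c\<^sup>2"
      using R l by simp
    finally show ?thesis .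
  qed
qed

text \<open>Chebyshev's inequality with the second moment at shift 0. Each step lowers
  \<open>(m - i) + (m - j)\<close> by one, so \<open>2 * m\<close> steps reach the border.\<close>

lemma walk_deviation:
  assumes "\<eta> > 0"
  shows "measure_pmf.prob (walk exact_gt m l X Y (2 * m) 0 0)
    {z. \<bar>z - block_total m l X Y 0 0\<bar> \<ge> \<eta>} \<le> 2 * real m / \<eta>\<^sup>2"
proof -
  let ?w = "walk exact_gt m l X Y (2 * m) 0 0"
  have fin: "finite (set_pmf ?w)"
    using l by (simp add: finite_set_walk)
  have "measure_pmf.prob ?w {z \<in> space ?w. \<bar>z - block_total m l X Y 0 0\<bar> \<ge> \<eta>}
      \<le> measure_pmf.expectation ?w (\<lambda>z. (z - block_total m l X Y 0 0)\<^sup>2) / \<eta>\<^sup>2"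
    using assms by (intro measure_pmf.second_moment_method integrable_measure_pmf_finite[OF fin]) auto
  also have "\<dots> \<le> 2 * real m / \<eta>\<^sup>2"
    using walk_second_moment[of 0 0 "2 * m" 0] by (intro divide_right_mono) auto
  finally show ?thesis by simp
qed

end

section \<open>The protocol\<close>

lemma dist_est_complexity_le:
  assumes "computes UNIV UNIV c K"
    and "\<And>p q. set_pmf p \<subseteq> X \<Longrightarrow> set_pmf q \<subseteq> Y \<Longrightarrow>
      measure_pmf.prob (K p q) {z. \<bar>z - mean_value f p q\<bar> \<le> \<epsilon>} \<ge> 2 / 3"
  shows "dist_est_complexity X Y f \<epsilon> \<le> enat c"
proof -
  obtain D where D: "\<forall>\<pi>\<in>set_pmf D. cost \<pi> \<le> c"
    "\<And>p q. map_pmf (\<lambda>\<pi>. run \<pi> p q) D = K p q"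
    using assms(1) unfolding computes_def by auto
  have "estimates D X Y f \<epsilon>"
    unfolding estimates_def
  proof (intro allI impI)
    fix p q
    assume "set_pmf p \<subseteq> X" "set_pmf q \<subseteq> Y"
    from assms(2)[OF this]
    show "2 / 3 \<le> measure_pmf.prob D {\<pi>. \<bar>run \<pi> p q - mean_value f p q\<bar> \<le> \<epsilon>}"
      by (simp add: vimage_def flip: D(2))
  qed
  with D(1) show ?thesis
    unfolding dist_est_complexity_def by (intro Inf_lower) auto
qed

text \<open>The grid bias and the sampling error each take half of \<epsilon>. Sampling fails with
  probability at most \<open>1 / 8\<close>, and the \<open>4 * m\<close> comparisons add at most
  \<open>1 / 6\<close>, which leaves \<open>17 / 24 \<ge> 2 / 3\<close>.\<close>

lemma greater_than_estimation:
  assumes m: "m > 0" "64 \<le> (real m) ^ 3 * \<epsilon>\<^sup>2" and l: "l > 0" "4 / \<epsilon> \<le> real (m * l)"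
    and L: "n < 2 ^ L" and d: "24 * real m \<le> 2 ^ d" and "\<epsilon> > 0"
  shows "dist_est_complexity (cube n) (cube n) greater_than \<epsilon> \<le> enat (4 * m * (36 * (L + d) + 1))"
proof (rule dist_est_complexity_le)
  define X where "X p = quantile (m * l) (map_pmf bits_val p)" for p
  define K where "K p q = map_pmf (\<lambda>z. z / (real m)\<^sup>2)
    (walk (gt_test n L d) m l (X p) (X q) (2 * m) 0 0)" for p q
  have "computes UNIV UNIV (2 * (36 * (L + d) + 1) * (2 * m) + 0) K"
    unfolding K_def map_pmf_def
    by (intro computes_bind computes_walk computes_return computes_comap[OF computes_gt_test[of UNIV UNIV]]) auto
  then show "computes UNIV UNIV (4 * m * (36 * (L + d) + 1)) K"
    by (simp add: algebra_simps)
  fix p q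
  assume p: "set_pmf p \<subseteq> cube n" and q: "set_pmf q \<subseteq> cube n"
  have N: "m * l > 0" using m l by simp
  have P: "set_pmf (map_pmf bits_val p) \<subseteq> {..<2 ^ n}" and Q: "set_pmf (map_pmf bits_val q) \<subseteq> {..<2 ^ n}"
    using p q bits_val_less by auto
  define V where "V = block_total m l (X p) (X q) 0 0"
  define \<mu> where "\<mu> = mean_value greater_than p q"
  \<comment> \<open>The allowance \<open>\<epsilon> / 2\<close> on the scale of the block total, a
    sum over \<open>m * m\<close> blocks.\<close>
  define \<eta> where "\<eta> = (real m)\<^sup>2 * \<epsilon> / 2"
  have \<eta>: "\<eta> > 0" using m \<open>\<epsilon> > 0\<close> by (simp add: \<eta>_def)
  have "V / (real m)\<^sup>2 = (\<Sum>a<m * l. \<Sum>b<m * l. of_bool (X q b \<le> X p a)) / (real (m * l))\<^sup>2"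
    by (simp add: V_def block_total_0_0 power_mult_distrib mult.commute del: sum_of_bool_eq)
  then have "\<bar>V / (real m)\<^sup>2 - \<mu>\<bar> \<le> 2 / real (m * l)"
    using quantile_grid_bias[OF N P Q] by (simp only: X_def \<mu>_def mean_value_greater_than)
  also have "\<dots> \<le> \<epsilon> / 2"
    using l \<open>\<epsilon> > 0\<close> N by (simp add: field_simps)
  finally have bias: "\<bar>V / (real m)\<^sup>2 - \<mu>\<bar> \<le> \<epsilon> / 2" .
  let ?E = "walk exact_gt m l (X p) (X q) (2 * m) 0 0"
  let ?S = "{z. \<bar>z - V\<bar> < \<eta>}"
  have "measure_pmf.prob ?E {z. \<bar>z - V\<bar> \<ge> \<eta>} \<le> 2 * real m / \<eta>\<^sup>2"
    unfolding V_def X_def using l(1) quantile_mono[OF N P] quantile_mono[OF N Q] \<eta>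
    by (intro walk_deviation) auto
  also have "\<dots> = 8 / ((real m) ^ 3 * \<epsilon>\<^sup>2)"
    using m \<open>\<epsilon> > 0\<close> by (simp add: \<eta>_def field_simps power2_eq_square power3_eq_cube)
  also have "\<dots> \<le> 8 / 64"
    using m by (intro divide_left_mono) auto
  finally have "measure_pmf.prob ?E {z. \<bar>z - V\<bar> \<ge> \<eta>} \<le> 1 / 8" by simp
  moreover have "?S = UNIV - {z. \<bar>z - V\<bar> \<ge> \<eta>}" by auto
  ultimately have E: "measure_pmf.prob ?E ?S \<ge> 7 / 8"
    using measure_pmf.prob_compl[of "{z. \<bar>z - V\<bar> \<ge> \<eta>}" ?E] by simp
  have "measure_pmf.prob ?E ?S - 2 * real (2 * m) * (1 / 2) ^ d
      \<le> measure_pmf.prob (walk (gt_test n L d) m l (X p) (X q) (2 * m) 0 0) ?S"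
    unfolding X_def using l(1) quantile_less[OF N P] quantile_less[OF N Q] L
    by (intro walk_noise gt_test_error) auto
  moreover have "2 * real (2 * m) * (1 / 2) ^ d \<le> 1 / 6"
    using d by (simp add: field_simps)
  ultimately have "2 / 3 \<le> measure_pmf.prob (walk (gt_test n L d) m l (X p) (X q) (2 * m) 0 0) ?S"
    using E by linarith
  also have "\<dots> \<le> measure_pmf.prob (walk (gt_test n L d) m l (X p) (X q) (2 * m) 0 0)
      {z. \<bar>z / (real m)\<^sup>2 - \<mu>\<bar> \<le> \<epsilon>}"
  proof (intro measure_pmf.finite_measure_mono subsetI CollectI)
    fix z
    assume "z \<in> ?S"
    then have "\<bar>z - V\<bar> / (real m)\<^sup>2 \<le> \<eta> / (real m)\<^sup>2"
      by (intro divide_right_mono) auto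
    also have "\<dots> = \<epsilon> / 2"
      using m by (simp add: \<eta>_def)
    finally have "\<bar>z / (real m)\<^sup>2 - V / (real m)\<^sup>2\<bar> \<le> \<epsilon> / 2"
      by (simp add: abs_divide flip: diff_divide_distrib)
    with bias show "\<bar>z / (real m)\<^sup>2 - \<mu>\<bar> \<le> \<epsilon>" by linarith
  qed simp
  finally show "2 / 3 \<le> measure_pmf.prob (K p q) {z. \<bar>z - mean_value greater_than p q\<bar> \<le> \<epsilon>}"
    by (simp add: K_def \<mu>_def vimage_def)
qed

text \<open>The constant answer \<open>1 / 2\<close> is good enough. This case is separate because
  the factor \<open>log 2 (1 / \<epsilon>)\<close> tends to 0 as \<epsilon> approaches 1.\<close>

lemma greater_than_trivial_estimation:
  assumes "1 / 2 \<le> \<epsilon>"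
  shows "dist_est_complexity (cube n) (cube n) greater_than \<epsilon> \<le> enat 0"
proof (rule dist_est_complexity_le[OF computes_return[of _ _ 0 "1 / 2"]])
  fix p q
  have "0 \<le> mean_value greater_than p q"
    unfolding mean_value_def
    by (intro Bochner_Integration.integral_nonneg) (auto simp: greater_than_def)
  moreover have "mean_value greater_than p q \<le> 1"
    unfolding mean_value_def
    by (auto intro!: measure_pmf.integral_le_const measure_pmf.integrable_const_bound[where B=1]
        simp: greater_than_def)
  ultimately have "\<bar>1 / 2 - mean_value greater_than p q\<bar> \<le> \<epsilon>"
    using assms by linarith
  then show "2 / 3 \<le> measure_pmf.prob (return_pmf (1 / 2)) {z. \<bar>z - mean_value greater_than p q\<bar> \<le> \<epsilon>}"
    by simp
qed

theorem theorem3p7: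
  "\<exists>(C::real) (k::nat). C > 0 \<and>
     (\<forall>(n::nat) (\<epsilon>::real). n \<ge> 2 \<longrightarrow> 0 < \<epsilon> \<longrightarrow> \<epsilon> < 1 \<longrightarrow>
        ereal_of_enat (dist_est_complexity (cube n) (cube n) greater_than \<epsilon>)
          \<le> ereal (C * (log 2 (1 / \<epsilon>)) ^ k * (log 2 (real n) / \<epsilon> powr (2 / 3))))"
\<comment> \<open>The constant is \<open>4 * 5 * 37 * 11\<close>, with 5 from
  \<open>m \<le> 5 * e\<close>, 37 from the cost of a comparison and 11 from
  \<open>L + d \<le> 11 * (a * t)\<close>.\<close>
proof (intro exI[of _ "8140::real"] exI[of _ "1::nat"] conjI allI impI)
  fix n :: nat and \<epsilon> :: real
  assume n: "n \<ge> 2" and \<epsilon>: "0 < \<epsilon>" "\<epsilon> < 1"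
  define b where "b = 8140 * (log 2 (1 / \<epsilon>)) ^ 1 * (log 2 (real n) / \<epsilon> powr (2 / 3))"
  have "\<exists>c. dist_est_complexity (cube n) (cube n) greater_than \<epsilon> \<le> enat c \<and> real c \<le> b"
  proof (cases "1 / 2 \<le> \<epsilon>")
    case True
    have "0 \<le> b"
      unfolding b_def using n \<epsilon>
      by (intro mult_nonneg_nonneg divide_nonneg_nonneg zero_le_power) auto
    with greater_than_trivial_estimation[OF True] show ?thesis
      by (intro exI[of _ 0]) simp
  next
    case False
    \<comment> \<open>Since \<open>e ^ 3 * \<epsilon>\<^sup>2 = 1\<close>, the choice
      \<open>m \<ge> 4 * e\<close> yields the required 64. The 120 in \<open>d\<close> comes from
      \<open>24 * m \<le> 120 * e \<le> 120 / \<epsilon>\<close>.\<close>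
    define e where "e = \<epsilon> powr (- 2 / 3)"
    define a where "a = log 2 (real n)"
    define t where "t = log 2 (1 / \<epsilon>)"
    define m where "m = nat \<lceil>4 * e\<rceil>"
    define l where "l = nat \<lceil>4 / \<epsilon>\<rceil>"
    define L where "L = nat \<lfloor>a\<rfloor> + 1"
    define d where "d = nat \<lceil>log 2 (120 / \<epsilon>)\<rceil>"
    have a: "1 \<le> a" using n by (simp add: a_def le_log_iff)
    have t: "1 \<le> t" using False \<epsilon> by (simp add: t_def le_log_iff field_simps)
    have "\<epsilon> powr 0 \<le> e"
      unfolding e_def using \<epsilon> by (intro powr_mono') auto
    then have e1: "1 \<le> e" using \<epsilon> by simp
    have "e \<le> \<epsilon> powr (- 1)"
      unfolding e_def using \<epsilon> by (intro powr_mono') auto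
    then have e2: "e \<le> 1 / \<epsilon>" using \<epsilon> by (simp add: powr_minus_divide)
    have "e ^ 3 = \<epsilon> powr (- 2)"
      using \<epsilon> by (simp add: e_def powr_power)
    then have e3: "e ^ 3 * \<epsilon>\<^sup>2 = 1"
      using \<epsilon> by (simp add: powr_minus_divide)
    have m: "4 * e \<le> real m" "real m \<le> 5 * e"
      unfolding m_def using e1 by linarith+
    have l1: "4 / \<epsilon> \<le> real l" unfolding l_def by linarith
    have "0 < 4 / \<epsilon>" using \<epsilon> by simp
    then have l0: "0 < l" using l1 by (cases "l = 0") auto
    have m0: "0 < m" using m e1 by (cases "m = 0") auto
    have "dist_est_complexity (cube n) (cube n) greater_than \<epsilon> \<le> enat (4 * m * (36 * (L + d) + 1))"
    proof (rule greater_than_estimation[OF m0 _ l0 _ _ _ \<epsilon>(1)])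
      have "64 = (4 * e) ^ 3 * \<epsilon>\<^sup>2"
        using e3 by (simp add: power_mult_distrib)
      also have "\<dots> \<le> (real m) ^ 3 * \<epsilon>\<^sup>2"
        using m e1 by (intro mult_right_mono power_mono) auto
      finally show "64 \<le> (real m) ^ 3 * \<epsilon>\<^sup>2" .
      have "1 * real l \<le> real m * real l"
        using m0 by (intro mult_right_mono) auto
      with l1 show "4 / \<epsilon> \<le> real (m * l)" by simp
      have "a < real L" unfolding L_def using a by linarith
      then have "2 powr a < 2 powr real L" by simp
      then have "real n < 2 ^ L"
        using n by (simp add: a_def powr_realpow)
      then show "n < 2 ^ L"
        by (metis of_nat_less_iff of_nat_numeral of_nat_power)
      have "24 * real m \<le> 120 * (1 / \<epsilon>)" using m e2 by linarith
      also have "\<dots> = 2 powr (log 2 (120 / \<epsilon>))" using \<epsilon> by simp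
      also have "\<dots> \<le> 2 powr (real d)"
        unfolding d_def by (intro powr_mono) (linarith, simp)
      finally show "24 * real m \<le> 2 ^ d" by (simp add: powr_realpow)
    qed
    moreover have "real (4 * m * (36 * (L + d) + 1)) \<le> b"
    proof -
      have L2: "real L \<le> 2 * a" unfolding L_def using a by linarith
      have "log 2 120 \<le> (7::real)" by (simp add: log_le_iff)
      moreover have "log 2 (120 / \<epsilon>) = log 2 120 + t"
        using \<epsilon> log_mult[of 2 120 "1 / \<epsilon>"] by (simp add: t_def)
      moreover have "0 \<le> log 2 (120::real)" by simp
      ultimately have d2: "real d \<le> 9 * t" unfolding d_def using t by linarith
      \<comment> \<open>As both logarithms are at least 1, the sum \<open>2 * a + 9 * t\<close> is
        bounded by a multiple of their product.\<close>
      have "a * 1 \<le> a * t" "1 * t \<le> a * t"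
        using a t by (intro mult_left_mono mult_right_mono; simp)+
      then have Ld: "real L + real d \<le> 11 * (a * t)" using L2 d2 by linarith
      have "1 \<le> real L" by (simp add: L_def)
      then have "36 * (real L + real d) + 1 \<le> 37 * (real L + real d)" by simp
      also have "\<dots> \<le> 407 * (a * t)" using Ld by simp
      finally have "4 * real m * (36 * (real L + real d) + 1) \<le> 4 * (5 * e) * (407 * (a * t))"
        using m e1 by (intro mult_mono) auto
      also have "\<dots> = b"
        using \<epsilon> by (simp add: b_def a_def t_def e_def powr_minus_divide)
      finally show ?thesis by (simp add: algebra_simps)
    qed
    ultimately show ?thesis by blast
  qed
  then obtain c where c: "dist_est_complexity (cube n) (cube n) greater_than \<epsilon> \<le> enat c" "real c \<le> b"
    by blast
  from c(1) have "ereal_of_enat (dist_est_complexity (cube n) (cube n) greater_than \<epsilon>) \<le> ereal_of_enat (enat c)"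
    by (simp only: ereal_of_enat_le_iff)
  also have "\<dots> \<le> ereal b" using c(2) by simp
  finally show "ereal_of_enat (dist_est_complexity (cube n) (cube n) greater_than \<epsilon>)
      \<le> ereal (8140 * (log 2 (1 / \<epsilon>)) ^ 1 * (log 2 (real n) / \<epsilon> powr (2 / 3)))"
    unfolding b_def .
qed simp

end
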